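(* Let $S\subset\mathbb H$ be a conjugacy class and let $\boldsymbol\alpha_i=(\alpha_{i,1},\ldots,\alpha_{i,k})$ ($i=1,2,3$) be three spherical chains of the same length $k$, all contained in $S$, and suppose $\alpha_{1,1}\neq\alpha_{2,1}$. Then there exist $k\times k$ matrices $A$ and $B$ over $\mathbb H$ such that $$\Delta_{\boldsymbol\ell}(\boldsymbol\alpha_3;f)=A\,\Delta_{\boldsymbol\ell}(\boldsymbol\alpha_1;f)+B\,\Delta_{\boldsymbol\ell}(\boldsymbol\alpha_2;f)\quad\text{for any } f\in\mathbb H[z].$$
   Context: $\mathbb H$ is the skew field of (real) quaternions. Two quaternions $\alpha,\beta$ are equivalent, $\alpha\sim\beta$, if $\alpha=h^{-1}\beta h$ for some nonzero $h\in\mathbb H$; the equivalence classes are called conjugacy classes. A spherical chain (of length $k$) is a finite ordered tuple $\boldsymbol\alpha=(\alpha_1,\ldots,\alpha_k)$ of quaternions with $\alpha_1\sim\alpha_2\sim\cdots\sim\alpha_k$ and $\alpha_{j+1}\neq\overline{\alpha}_j$ for $j=1,\ldots,k-1$. $\mathbb H[z]$ is the ring of polynomials in one formal variable $z$ which commutes with the quaternion coefficients. For $f(z)=\sum_{j=0}^m z^jf_j$ and $\alpha\in\mathbb H$, the left evaluation is $f^{\boldsymbol{e_\ell}}(\alpha)=\sum_{j=0}^m\alpha^jf_j$, and $L_\alpha f$ is the polynomial $(L_\alpha f)(z)=\sum_{k=0}^{m-1}\big(\sum_{j=0}^{m-k-1}\alpha^jf_{k+j+1}\big)z^k$, i.e.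 the unique polynomial with $f(z)=f^{\boldsymbol{e_\ell}}(\alpha)+(z-\alpha)(L_\alpha f)(z)$. Left divided differences are $[\alpha_1;f]_{\boldsymbol\ell}=f^{\boldsymbol{e_\ell}}(\alpha_1)$ and $[\alpha_1,\ldots,\alpha_j;f]_{\boldsymbol\ell}=(L_{\alpha_{j-1}}\cdots L_{\alpha_1}f)^{\boldsymbol{e_\ell}}(\alpha_j)$ for $j\ge2$. For $\boldsymbol\alpha=(\alpha_1,\ldots,\alpha_k)$, $\Delta_{\boldsymbol\ell}(\boldsymbol\alpha;f)\in\mathbb H^{k}$ denotes the column with entries $[\alpha_1;f]_{\boldsymbol\ell},[\alpha_1,\alpha_2;f]_{\boldsymbol\ell},\ldots,[\alpha_1,\ldots,\alpha_k;f]_{\boldsymbol\ell}$ (top to bottom). *)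

theory Defs
  imports "Jordan_Normal_Form.Matrix" "HOL-Computational_Algebra.Polynomial" Complex_Main
begin

section \<open>Quaternions\<close>

text \<open>\<open>Quat a b c d\<close> is $a + b i + c j + d k$.\<close>

datatype quat = Quat (qRe: real) (qIm1: real) (qIm2: real) (qIm3: real)

instantiation quat :: ring_1
begin

definition "0 = Quat 0 0 0 0"

definition "1 = Quat 1 0 0 0"

definition "x + y =
  Quat (qRe x + qRe y) (qIm1 x + qIm1 y) (qIm2 x + qIm2 y) (qIm3 x + qIm3 y)"

definition "- x = Quat (- qRe x) (- qIm1 x) (- qIm2 x) (- qIm3 x)"

definition "x - y =
  Quat (qRe x - qRe y) (qIm1 x - qIm1 y) (qIm2 x - qIm2 y) (qIm3 x - qIm3 y)"

definition "x * y = Quat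
  (qRe x * qRe y - qIm1 x * qIm1 y - qIm2 x * qIm2 y - qIm3 x * qIm3 y)
  (qRe x * qIm1 y + qIm1 x * qRe y + qIm2 x * qIm3 y - qIm3 x * qIm2 y)
  (qRe x * qIm2 y - qIm1 x * qIm3 y + qIm2 x * qRe y + qIm3 x * qIm1 y)
  (qRe x * qIm3 y + qIm1 x * qIm2 y - qIm2 x * qIm1 y + qIm3 x * qRe y)"

instance
  by standard
    (auto simp: zero_quat_def one_quat_def plus_quat_def uminus_quat_def minus_quat_def
      times_quat_def algebra_simps)

end

lemma quat_units:
  defines "i \<equiv> Quat 0 1 0 0" and "j \<equiv> Quat 0 0 1 0" and "k \<equiv> Quat 0 0 0 1"
  shows "i * i = - 1" "j * j = - 1" "k * k = - 1" "i * j * k = - 1"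
  by (simp_all add: i_def j_def k_def times_quat_def one_quat_def uminus_quat_def)

definition quat_norm_sq :: "quat \<Rightarrow> real" where
  "quat_norm_sq x = (qRe x)\<^sup>2 + (qIm1 x)\<^sup>2 + (qIm2 x)\<^sup>2 + (qIm3 x)\<^sup>2"

lemma quat_norm_sq_eq_0_iff: "quat_norm_sq x = 0 \<longleftrightarrow> x = 0"
  by (cases x) (auto simp: quat_norm_sq_def zero_quat_def add_nonneg_eq_0_iff)

instantiation quat :: division_ring
begin

definition "inverse x = Quat (qRe x / quat_norm_sq x) (- qIm1 x / quat_norm_sq x)
  (- qIm2 x / quat_norm_sq x) (- qIm3 x / quat_norm_sq x)"

definition "x div y = x * inverse (y :: quat)"

instance
proof
  fix x y :: quat
  show "x div y = x * inverse y"
    by (fact divide_quat_def)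
  show "inverse (0 :: quat) = 0"
    by (simp add: inverse_quat_def zero_quat_def)
  assume "x \<noteq> 0"
  then have nz: "quat_norm_sq x \<noteq> 0"
    by (simp add: quat_norm_sq_eq_0_iff)
  then have "(qRe x * qRe x + qIm1 x * qIm1 x + qIm2 x * qIm2 x + qIm3 x * qIm3 x)
      / quat_norm_sq x = 1"
    by (simp add: quat_norm_sq_def power2_eq_square)
  then show "inverse x * x = 1" "x * inverse x = 1"
    by (auto simp: inverse_quat_def times_quat_def one_quat_def add_divide_distrib)
qed

end

definition quat_cnj :: "quat \<Rightarrow> quat" where
  "quat_cnj x = Quat (qRe x) (- qIm1 x) (- qIm2 x) (- qIm3 x)"

definition quat_equiv :: "quat \<Rightarrow> quat \<Rightarrow> bool"  (infix \<open>\<sim>\<^sub>q\<close> 50) where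
  "\<alpha> \<sim>\<^sub>q \<beta> \<longleftrightarrow> (\<exists>h. h \<noteq> 0 \<and> \<alpha> = inverse h * \<beta> * h)"

lemma equiv_quat_equiv: "equiv UNIV {(\<alpha>, \<beta>). \<alpha> \<sim>\<^sub>q \<beta>}"
proof (rule equivI)
  show "refl {(\<alpha>, \<beta>). \<alpha> \<sim>\<^sub>q \<beta>}"
    by (auto simp: refl_on_def quat_equiv_def intro: exI[of _ 1])
  show "sym {(\<alpha>, \<beta>). \<alpha> \<sim>\<^sub>q \<beta>}"
  proof (rule symI, clarsimp)
    fix \<alpha> \<beta> assume "\<alpha> \<sim>\<^sub>q \<beta>"
    then obtain h where h: "h \<noteq> 0" "\<alpha> = inverse h * \<beta> * h"
      unfolding quat_equiv_def by blast
    have "inverse (inverse h) * \<alpha> * inverse h = (h * inverse h) * \<beta> * (h * inverse h)"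
      unfolding h(2) nonzero_inverse_inverse_eq[OF h(1)] by (simp only: mult.assoc)
    with h(1) have "inverse h \<noteq> 0 \<and> \<beta> = inverse (inverse h) * \<alpha> * inverse h"
      by simp
    then show "\<beta> \<sim>\<^sub>q \<alpha>"
      unfolding quat_equiv_def by blast
  qed
  show "trans {(\<alpha>, \<beta>). \<alpha> \<sim>\<^sub>q \<beta>}"
  proof (rule transI, clarsimp)
    fix \<alpha> \<beta> \<gamma> assume "\<alpha> \<sim>\<^sub>q \<beta>" "\<beta> \<sim>\<^sub>q \<gamma>"
    then obtain g h where gh: "g \<noteq> 0" "\<alpha> = inverse g * \<beta> * g" "h \<noteq> 0" "\<beta> = inverse h * \<gamma> * h"
      unfolding quat_equiv_def by blast
    then have "h * g \<noteq> 0 \<and> \<alpha> = inverse (h * g) * \<gamma> * (h * g)"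
      by (simp add: nonzero_inverse_mult_distrib mult.assoc)
    then show "\<alpha> \<sim>\<^sub>q \<gamma>"
      unfolding quat_equiv_def by blast
  qed
qed simp

definition conjugacy_classes :: "quat set set" where
  "conjugacy_classes = UNIV // {(\<alpha>, \<beta>). \<alpha> \<sim>\<^sub>q \<beta>}"

text \<open>Tuples are lists, so the entry $\alpha_{j+1}$ of the tuple is \<open>\<alpha>s ! j\<close>.\<close>

definition spherical_chain :: "quat list \<Rightarrow> bool" where
  "spherical_chain \<alpha>s \<longleftrightarrow> \<alpha>s \<noteq> [] \<and>
     (\<forall>j. Suc j < length \<alpha>s \<longrightarrow> \<alpha>s ! j \<sim>\<^sub>q \<alpha>s ! Suc j \<and> \<alpha>s ! Suc j \<noteq> quat_cnj (\<alpha>s ! j))"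


section \<open>Left evaluation and left divided differences\<close>

text \<open>
  The polynomial ring over the quaternions, with central variable, is represented by
  \<^typ>\<open>quat poly\<close>.  The library provides multiplication on \<open>'a poly\<close> only for
  commutative coefficients; evaluation and division by $z - \alpha$ are therefore given by their
  coefficient formulas, and the library's \<^const>\<open>poly\<close> is not used.
\<close>

definition left_eval :: "quat poly \<Rightarrow> quat \<Rightarrow> quat" where
  "left_eval f \<alpha> = (\<Sum>j\<le>degree f. \<alpha> ^ j * coeff f j)"

text \<open>For $m = \deg f$ and $k < m$, the range $0 \le j \le m - k - 1$ is \<open>{..<m - k}\<close>.\<close>

definition left_quotient :: "quat \<Rightarrow> quat poly \<Rightarrow> quat poly" where
  "left_quotient \<alpha> f =
     (\<Sum>k<degree f. monom (\<Sum>j<degree f - k. \<alpha> ^ j * coeff f (k + j + 1)) k)"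

text \<open>
  The identity $f(z) = f^{e_\ell}(\alpha) + (z - \alpha)\,(L_\alpha f)(z)$, coefficient by
  coefficient.
\<close>

lemma coeff_left_quotient:
  "coeff (left_quotient \<alpha> f) k = (\<Sum>j<degree f - k. \<alpha> ^ j * coeff f (k + j + 1))"
proof -
  have "coeff (left_quotient \<alpha> f) k =
      (\<Sum>l<degree f. if l = k then \<Sum>j<degree f - l. \<alpha> ^ j * coeff f (l + j + 1) else 0)"
    unfolding left_quotient_def by (simp add: coeff_sum)
  also have "\<dots> = (\<Sum>j<degree f - k. \<alpha> ^ j * coeff f (k + j + 1))"
    by (simp add: sum.delta)
  finally show ?thesis .
qed

lemma left_division:
  shows "coeff f 0 = left_eval f \<alpha> - \<alpha> * coeff (left_quotient \<alpha> f) 0"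
    and "coeff f (Suc n) = coeff (left_quotient \<alpha> f) n - \<alpha> * coeff (left_quotient \<alpha> f) (Suc n)"
proof -
  have "left_eval f \<alpha> = (\<Sum>j<Suc (degree f). \<alpha> ^ j * coeff f j)"
    by (simp add: left_eval_def lessThan_Suc_atMost)
  then show "coeff f 0 = left_eval f \<alpha> - \<alpha> * coeff (left_quotient \<alpha> f) 0"
    unfolding sum.lessThan_Suc_shift
    by (simp add: coeff_left_quotient sum_distrib_left mult.assoc)
next
  show "coeff f (Suc n) = coeff (left_quotient \<alpha> f) n - \<alpha> * coeff (left_quotient \<alpha> f) (Suc n)"
  proof (cases "n < degree f")
    case True
    then have "degree f - n = Suc (degree f - Suc n)"
      by simp
    then have "coeff (left_quotient \<alpha> f) n =
        (\<Sum>j<Suc (degree f - Suc n). \<alpha> ^ j * coeff f (n + j + 1))"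
      by (simp add: coeff_left_quotient)
    then show ?thesis
      unfolding sum.lessThan_Suc_shift
      by (simp add: coeff_left_quotient sum_distrib_left mult.assoc)
  next
    case False
    then show ?thesis
      by (simp add: coeff_left_quotient coeff_eq_0)
  qed
qed

text \<open>
  \<open>fold left_quotient [\<alpha>\<^sub>1, \<dots>, \<alpha>\<^sub>m] f\<close> is $L_{\alpha_m} \cdots L_{\alpha_1} f$, with
  $L_{\alpha_1}$ applied first.
\<close>

definition left_divided_difference :: "quat list \<Rightarrow> quat poly \<Rightarrow> quat" where
  "left_divided_difference \<alpha>s f = left_eval (fold left_quotient (butlast \<alpha>s) f) (last \<alpha>s)"

definition left_divided_differences :: "quat list \<Rightarrow> quat poly \<Rightarrow> quat vec" where
  "left_divided_differences \<alpha>s f =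
     vec (length \<alpha>s) (\<lambda>i. left_divided_difference (take (Suc i) \<alpha>s) f)"

end

theory Submission
  imports Defs
begin

text \<open>
  All elements of $S$ have the same characteristic polynomial $\chi$, which is quadratic with real
  coefficients.  Since $\chi = (z - \alpha)(z - \overline\alpha)$ is central,
  $[\alpha_1, \dots, \alpha_j; \chi^{j-1} g] = c\, g^{e_\ell}(\alpha_1)$ with
  $c = (\alpha_j - \overline\alpha_{j-1}) \cdots (\alpha_2 - \overline\alpha_1)$, which is nonzero
  for a spherical chain.  In particular divided differences along chains of length at most $k$
  annihilate the multiples of $\chi^k$.  Conversely, every right linear functional that annihilates
  the multiples of $\chi^m$ is a left combination of the first $m$ divided differences along
  $\boldsymbol\alpha_1$ and along $\boldsymbol\alpha_2$: for $m = 1$ because left evaluations at two distinct points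
  of $S$ determine the remainder modulo $\chi$, and then by induction, as the formula above allows
  one to correct the functional on $\chi^{m-1} \mathbb H[z]$ by the two differences of order $m$.
\<close>

section \<open>Trace and norm of quaternions\<close>

lemma qRe_mult_commute: "qRe (x * y) = qRe (y * x)"
  by (simp add: times_quat_def)

lemma quat_norm_sq_mult: "quat_norm_sq (x * y) = quat_norm_sq x * quat_norm_sq y"
  by (simp add: quat_norm_sq_def times_quat_def power2_eq_square algebra_simps)

text \<open>Cyclic invariance of the real part lets \<open>h\<close> and its inverse cancel.\<close>

lemma quat_equiv_qRe: "qRe \<alpha> = qRe \<beta>" if eq: "\<alpha> \<sim>\<^sub>q \<beta>"
proof -
  obtain h where h: "h \<noteq> 0" "\<alpha> = inverse h * \<beta> * h"
    using eq by (auto simp: quat_equiv_def)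
  have "qRe \<alpha> = qRe (h * (inverse h * \<beta>))"
    unfolding h(2) by (rule qRe_mult_commute)
  also have "h * (inverse h * \<beta>) = \<beta>"
    using h(1) by (simp flip: mult.assoc)
  finally show ?thesis .
qed

text \<open>Multiplicativity of the norm, applied to
  \<open>h * \<alpha> = \<beta> * h\<close>.\<close>

lemma quat_equiv_norm_sq: "quat_norm_sq \<alpha> = quat_norm_sq \<beta>" if eq: "\<alpha> \<sim>\<^sub>q \<beta>"
proof -
  obtain h where h: "h \<noteq> 0" "\<alpha> = inverse h * \<beta> * h"
    using eq by (auto simp: quat_equiv_def)
  have "h * \<alpha> = \<beta> * h"
    unfolding h(2) using h(1) by (simp flip: mult.assoc)
  then have "quat_norm_sq h * quat_norm_sq \<alpha> = quat_norm_sq \<beta> * quat_norm_sq h"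
    by (metis quat_norm_sq_mult)
  with h(1) show ?thesis
    by (simp add: quat_norm_sq_eq_0_iff)
qed

lemma conjugacy_class_equiv:
  assumes "S \<in> conjugacy_classes" "\<alpha> \<in> S" "\<beta> \<in> S"
  shows "\<alpha> \<sim>\<^sub>q \<beta>"
  using quotient_eq_iff[OF equiv_quat_equiv, of S S \<alpha> \<beta>] assms
  by (simp add: conjugacy_classes_def)

lemma real_quat_commute: "Quat r 0 0 0 * x = x * Quat r 0 0 0"
  by (simp add: times_quat_def)

lemma quat_add_cnj: "x + quat_cnj x = Quat (2 * qRe x) 0 0 0"
  by (simp add: plus_quat_def quat_cnj_def)

lemma quat_mult_cnj: "x * quat_cnj x = Quat (quat_norm_sq x) 0 0 0"
  by (simp add: times_quat_def quat_cnj_def quat_norm_sq_def power2_eq_square)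

lemma quat_cnj_cnj [simp]: "quat_cnj (quat_cnj x) = x"
  by (simp add: quat_cnj_def)

lemma qRe_cnj [simp]: "qRe (quat_cnj x) = qRe x"
  by (simp add: quat_cnj_def)

lemma quat_norm_sq_cnj [simp]: "quat_norm_sq (quat_cnj x) = quat_norm_sq x"
  by (simp add: quat_cnj_def quat_norm_sq_def)


section \<open>Multiplication by linear factors\<close>

text \<open>\<open>linear_mult \<alpha> f\<close> is $(z - \alpha) f(z)$.\<close>

definition linear_mult :: "quat \<Rightarrow> quat poly \<Rightarrow> quat poly" where
  "linear_mult \<alpha> f = pCons 0 f - map_poly ((*) \<alpha>) f"

text \<open>Multiplication by the characteristic polynomial \<chi> = z^2 - 2 Re(\<alpha>) z +
  |\<alpha>|^2, kept factored so that z - \<alpha> can be divided off at once.\<close>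

definition char_mult :: "quat \<Rightarrow> quat poly \<Rightarrow> quat poly" where
  "char_mult \<alpha> f = linear_mult \<alpha> (linear_mult (quat_cnj \<alpha>) f)"

text \<open>Right multiplication by a constant; \<^const>\<open>smult\<close> needs commutative coefficients.\<close>

definition right_scale :: "quat poly \<Rightarrow> quat \<Rightarrow> quat poly" where
  "right_scale f c = map_poly (\<lambda>x. x * c) f"

lemma coeff_linear_mult:
  "coeff (linear_mult \<alpha> f) n = (case n of 0 \<Rightarrow> 0 | Suc m \<Rightarrow> coeff f m) - \<alpha> * coeff f n"
  by (simp add: linear_mult_def coeff_map_poly coeff_pCons)

lemma coeff_right_scale [simp]: "coeff (right_scale f c) n = coeff f n * c"
  by (simp add: right_scale_def coeff_map_poly)

lemma right_scale_pCons: "right_scale (pCons a f) c = pCons (a * c) (right_scale f c)"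
  by (rule poly_eqI) (simp add: coeff_pCons split: nat.split)

lemma right_scale_0 [simp]: "right_scale 0 c = 0"
  by (rule poly_eqI) simp

lemma linear_mult_add: "linear_mult \<alpha> (f + g) = linear_mult \<alpha> f + linear_mult \<alpha> g"
  by (rule poly_eqI) (simp add: coeff_linear_mult algebra_simps split: nat.split)

lemma linear_mult_right_scale:
  "linear_mult \<alpha> (right_scale f c) = right_scale (linear_mult \<alpha> f) c"
  by (rule poly_eqI) (simp add: coeff_linear_mult algebra_simps split: nat.split)

lemma linear_mult_const: "linear_mult \<alpha> [:c:] = [:- (\<alpha> * c), c:]"
  by (rule poly_eqI) (simp add: coeff_linear_mult coeff_pCons split: nat.split)

lemma linear_mult_linear_mult:
  "coeff (linear_mult \<alpha> (linear_mult \<beta> f)) n =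
     (case n of 0 \<Rightarrow> 0 | Suc m \<Rightarrow> (case m of 0 \<Rightarrow> 0 | Suc l \<Rightarrow> coeff f l) - (\<alpha> + \<beta>) * coeff f m)
     + \<alpha> * \<beta> * coeff f n"
  by (simp add: coeff_linear_mult algebra_simps split: nat.split)

text \<open>Only real constants occur, and they depend on \<alpha> through trace and norm alone:
  hence \<chi> is central and shared by the whole conjugacy class.\<close>

lemma coeff_char_mult:
  "coeff (char_mult \<alpha> f) n =
     (case n of 0 \<Rightarrow> 0 | Suc m \<Rightarrow>
        (case m of 0 \<Rightarrow> 0 | Suc l \<Rightarrow> coeff f l) - Quat (2 * qRe \<alpha>) 0 0 0 * coeff f m)
     + Quat (quat_norm_sq \<alpha>) 0 0 0 * coeff f n"
  unfolding char_mult_def linear_mult_linear_mult quat_add_cnj quat_mult_cnj ..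

lemma char_mult_cong: "\<alpha> \<sim>\<^sub>q \<beta> \<Longrightarrow> char_mult \<alpha> = char_mult \<beta>"
  by (intro ext poly_eqI) (simp add: coeff_char_mult quat_equiv_qRe quat_equiv_norm_sq
      split: nat.split)

lemma char_mult_cnj: "char_mult (quat_cnj \<alpha>) = char_mult \<alpha>"
  by (intro ext poly_eqI) (simp add: coeff_char_mult split: nat.split)

lemma char_mult_linear_mult:
  "char_mult \<alpha> (linear_mult \<beta> f) = linear_mult \<beta> (char_mult \<alpha> f)"
proof (rule poly_eqI)
  fix n
  have comm: "\<beta> * (Quat r 0 0 0 * x) = Quat r 0 0 0 * (\<beta> * x)" for r x
    by (metis real_quat_commute mult.assoc)
  show "coeff (char_mult \<alpha> (linear_mult \<beta> f)) n = coeff (linear_mult \<beta> (char_mult \<alpha> f)) n"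
    by (simp add: coeff_char_mult coeff_linear_mult distrib_left right_diff_distrib comm
        split: nat.split)
qed

lemma funpow_char_mult_linear_mult:
  "(char_mult \<alpha> ^^ m) (linear_mult \<beta> f) = linear_mult \<beta> ((char_mult \<alpha> ^^ m) f)"
  by (induction m) (simp_all add: char_mult_linear_mult)


section \<open>Left division with remainder\<close>

lemma left_division_poly: "f = [:left_eval f \<alpha>:] + linear_mult \<alpha> (left_quotient \<alpha> f)"
proof (rule poly_eqI)
  fix n
  show "coeff f n = coeff ([:left_eval f \<alpha>:] + linear_mult \<alpha> (left_quotient \<alpha> f)) n"
    using left_division(1)[of f \<alpha>] left_division(2)[of f _ \<alpha>]
    by (cases n) (simp_all add: coeff_linear_mult)
qed

text \<open>The coefficients of positive index give q_n = \<alpha> q_(n+1); iterating this runs past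
  the degree of q.\<close>

lemma linear_mult_eq_const:
  assumes "linear_mult \<alpha> q = [:r:]"
  shows "q = 0"
proof (rule poly_eqI)
  fix n
  have step: "coeff q n = \<alpha> * coeff q (Suc n)" for n
    using arg_cong[OF assms, of "\<lambda>p. coeff p (Suc n)"] by (simp add: coeff_linear_mult)
  have "coeff q n = \<alpha> ^ m * coeff q (n + m)" for m
  proof (induction m)
    case (Suc m)
    then show ?case
      using step[of "n + m"] by (simp add: power_Suc2 mult.assoc del: power_Suc)
  qed simp
  from this[of "Suc (degree q)"] show "coeff q n = coeff 0 n"
    by (simp add: coeff_eq_0)
qed

text \<open>The main computational tool: values and quotients are later found by exhibiting a
  decomposition of this shape.\<close>

lemma left_division_unique:
  assumes "f = [:r:] + linear_mult \<alpha> q"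
  shows "left_eval f \<alpha> = r" and "left_quotient \<alpha> f = q"
proof -
  let ?e = "left_eval f \<alpha>" and ?L = "left_quotient \<alpha> f"
  \<comment> \<open>Splitting \<open>?L\<close> as \<open>(?L - q) + q\<close> allows q to be
    cancelled by additivity alone.\<close>
  have "[:r:] + linear_mult \<alpha> q = [:?e:] + linear_mult \<alpha> ((?L - q) + q)"
    using assms left_division_poly[of f \<alpha>] by simp
  then have "[:r:] = [:?e:] + linear_mult \<alpha> (?L - q)"
    by (simp only: linear_mult_add flip: add.assoc) simp
  then have "linear_mult \<alpha> (?L - q) = [:r:] - [:?e:]"
    by (metis add_diff_cancel_left')
  then have *: "linear_mult \<alpha> (?L - q) = [:r - ?e:]"
    by simp
  then have "?L - q = 0"
    by (rule linear_mult_eq_const)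
  with * show "?e = r" "?L = q"
    by (simp_all add: linear_mult_def)
qed

lemma left_eval_linear_mult [simp]: "left_eval (linear_mult \<alpha> f) \<alpha> = 0"
  and left_quotient_linear_mult [simp]: "left_quotient \<alpha> (linear_mult \<alpha> f) = f"
  using left_division_unique[of "linear_mult \<alpha> f" 0 \<alpha> f] by simp_all

lemma left_eval_char_mult [simp]: "left_eval (char_mult \<alpha> f) \<alpha> = 0"
  by (simp add: char_mult_def)

lemma left_division_add:
  "left_eval (f + g) \<alpha> = left_eval f \<alpha> + left_eval g \<alpha>"
  "left_quotient \<alpha> (f + g) = left_quotient \<alpha> f + left_quotient \<alpha> g"
proof -
  have "f + g = [:left_eval f \<alpha> + left_eval g \<alpha>:]
      + linear_mult \<alpha> (left_quotient \<alpha> f + left_quotient \<alpha> g)"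
    (is "_ = [:?e + ?e':] + linear_mult \<alpha> (?q + ?q')")
  proof -
    have "f + g = ([:?e:] + linear_mult \<alpha> ?q) + ([:?e':] + linear_mult \<alpha> ?q')"
      by (intro arg_cong2[where f = "(+)"] left_division_poly)
    also have "\<dots> = ([:?e:] + [:?e':]) + (linear_mult \<alpha> ?q + linear_mult \<alpha> ?q')"
      by (simp only: ac_simps)
    finally show ?thesis
      by (simp add: linear_mult_add)
  qed
  from left_division_unique[OF this]
  show "left_eval (f + g) \<alpha> = left_eval f \<alpha> + left_eval g \<alpha>"
    "left_quotient \<alpha> (f + g) = left_quotient \<alpha> f + left_quotient \<alpha> g" .
qed

lemma right_scale_add: "right_scale (f + g) c = right_scale f c + right_scale g c"
  by (rule poly_eqI) (simp add: distrib_right)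

lemma left_division_right_scale:
  "left_eval (right_scale f c) \<alpha> = left_eval f \<alpha> * c"
  "left_quotient \<alpha> (right_scale f c) = right_scale (left_quotient \<alpha> f) c"
proof -
  have "right_scale f c = right_scale ([:left_eval f \<alpha>:] + linear_mult \<alpha> (left_quotient \<alpha> f)) c"
    using left_division_poly[of f \<alpha>] by simp
  also have "\<dots> = [:left_eval f \<alpha> * c:] + linear_mult \<alpha> (right_scale (left_quotient \<alpha> f) c)"
    by (simp add: right_scale_add right_scale_pCons linear_mult_right_scale)
  finally have "right_scale f c =
      [:left_eval f \<alpha> * c:] + linear_mult \<alpha> (right_scale (left_quotient \<alpha> f) c)" .
  from left_division_unique[OF this]
  show "left_eval (right_scale f c) \<alpha> = left_eval f \<alpha> * c"
    "left_quotient \<alpha> (right_scale f c) = right_scale (left_quotient \<alpha> f) c" .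
qed

text \<open>Dividing g by z - \<alpha> turns the non-constant part into a multiple of \<chi>, which
  z - \<beta> divides as well; only the constant remainder of g contributes.\<close>

lemma left_eval_linear_mult_cnj:
  assumes "\<alpha> \<sim>\<^sub>q \<beta>"
  shows "left_eval (linear_mult (quat_cnj \<alpha>) g) \<beta> = (\<beta> - quat_cnj \<alpha>) * left_eval g \<alpha>"
proof -
  let ?e = "left_eval g \<alpha>" and ?q = "left_quotient \<alpha> g"
  have "linear_mult (quat_cnj \<alpha>) g = linear_mult (quat_cnj \<alpha>) ([:?e:] + linear_mult \<alpha> ?q)"
    using left_division_poly[of g \<alpha>] by simp
  also have "\<dots> = linear_mult (quat_cnj \<alpha>) [:?e:] + char_mult (quat_cnj \<alpha>) ?q"
    by (simp add: linear_mult_add char_mult_def)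
  also have "char_mult (quat_cnj \<alpha>) ?q = linear_mult \<beta> (linear_mult (quat_cnj \<beta>) ?q)"
    using char_mult_cong[OF assms] by (simp add: char_mult_cnj char_mult_def)
  also have "linear_mult (quat_cnj \<alpha>) [:?e:] = [:(\<beta> - quat_cnj \<alpha>) * ?e:] + linear_mult \<beta> [:?e:]"
    by (simp add: linear_mult_const left_diff_distrib)
  finally have "linear_mult (quat_cnj \<alpha>) g =
      [:(\<beta> - quat_cnj \<alpha>) * ?e:] + linear_mult \<beta> ([:?e:] + linear_mult (quat_cnj \<beta>) ?q)"
    by (simp add: linear_mult_add algebra_simps)
  then show ?thesis
    by (rule left_division_unique)
qed

text \<open>One factor \<chi> gives up its z - \<alpha>; the other factors are central and move past
  what is left.\<close>

lemma left_quotient_char_mult: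
  "left_quotient \<alpha> ((char_mult \<alpha> ^^ Suc m) g) = (char_mult \<alpha> ^^ m) (linear_mult (quat_cnj \<alpha>) g)"
proof -
  have "(char_mult \<alpha> ^^ Suc m) g = linear_mult \<alpha> (linear_mult (quat_cnj \<alpha>) ((char_mult \<alpha> ^^ m) g))"
    by (simp add: char_mult_def)
  then show ?thesis
    by (simp add: funpow_char_mult_linear_mult del: funpow.simps)
qed


section \<open>Right linear functionals and divided differences\<close>

definition right_linear :: "(quat poly \<Rightarrow> quat) \<Rightarrow> bool" where
  "right_linear \<phi> \<longleftrightarrow>
     (\<forall>f g. \<phi> (f + g) = \<phi> f + \<phi> g) \<and> (\<forall>f c. \<phi> (right_scale f c) = \<phi> f * c)"

lemma right_linear_left_divided_difference: "right_linear (left_divided_difference \<alpha>s)"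
proof -
  have "fold left_quotient \<beta>s (f + g) = fold left_quotient \<beta>s f + fold left_quotient \<beta>s g"
    "fold left_quotient \<beta>s (right_scale f c) = right_scale (fold left_quotient \<beta>s f) c" for \<beta>s f g c
    by (induction \<beta>s arbitrary: f g) (simp_all add: left_division_add left_division_right_scale)
  then show ?thesis
    by (simp add: right_linear_def left_divided_difference_def left_division_add
        left_division_right_scale)
qed

lemma right_linear_diff_mult:
  "right_linear \<phi> \<Longrightarrow> right_linear \<psi> \<Longrightarrow> right_linear (\<lambda>f. \<phi> f - a * \<psi> f)"
  by (simp add: right_linear_def algebra_simps)

lemma right_linear_funpow_char_mult:
  assumes "right_linear \<phi>"
  shows "right_linear (\<lambda>g. \<phi> ((char_mult \<alpha> ^^ m) g))"
proof -
  have "(char_mult \<alpha> ^^ m) (f + g) = (char_mult \<alpha> ^^ m) f + (char_mult \<alpha> ^^ m) g"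
    "(char_mult \<alpha> ^^ m) (right_scale f c) = right_scale ((char_mult \<alpha> ^^ m) f) c" for f g c
    by (induction m) (simp_all add: char_mult_def linear_mult_add linear_mult_right_scale)
  with assms show ?thesis
    by (simp add: right_linear_def)
qed

section \<open>Divided differences of multiples of powers of \<chi>\<close>

lemma spherical_chain_Cons:
  "spherical_chain (\<alpha> # \<beta> # \<gamma>s) \<longleftrightarrow> \<alpha> \<sim>\<^sub>q \<beta> \<and> \<beta> \<noteq> quat_cnj \<alpha> \<and> spherical_chain (\<beta> # \<gamma>s)"
  unfolding spherical_chain_def by (auto simp: nth_Cons split: nat.splits)

lemma spherical_chain_take:
  "spherical_chain \<alpha>s \<Longrightarrow> spherical_chain (take (Suc i) \<alpha>s)"
  by (auto simp: spherical_chain_def)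

text \<open>Induction along the chain: the quotient at \<alpha> uses up one \<chi> and leaves z
  minus the conjugate of \<alpha>, whose value at the next node is nonzero by the chain
  condition.\<close>

lemma left_divided_difference_char_mult:
  assumes "spherical_chain (\<alpha> # \<beta>s)"
  shows "\<exists>c. c \<noteq> 0 \<and> (\<forall>g. left_divided_difference (\<alpha> # \<beta>s)
    ((char_mult \<alpha> ^^ length \<beta>s) g) = c * left_eval g \<alpha>)"
  using assms
proof (induction \<beta>s arbitrary: \<alpha>)
  case Nil
  show ?case
    by (rule exI[of _ 1]) (simp add: left_divided_difference_def)
next
  case (Cons \<beta> \<beta>s)
  then have eq: "\<alpha> \<sim>\<^sub>q \<beta>" and ne: "\<beta> - quat_cnj \<alpha> \<noteq> 0" and ch: "spherical_chain (\<beta> # \<beta>s)"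
    by (auto simp: spherical_chain_Cons)
  obtain c where c: "c \<noteq> 0"
    "\<And>g. left_divided_difference (\<beta> # \<beta>s) ((char_mult \<beta> ^^ length \<beta>s) g) = c * left_eval g \<beta>"
    using Cons.IH[OF ch] by blast
  have "left_divided_difference (\<alpha> # \<beta> # \<beta>s) ((char_mult \<alpha> ^^ length (\<beta> # \<beta>s)) g)
      = c * (\<beta> - quat_cnj \<alpha>) * left_eval g \<alpha>" for g
  proof -
    have "left_divided_difference (\<alpha> # \<beta> # \<beta>s) ((char_mult \<alpha> ^^ length (\<beta> # \<beta>s)) g)
        = left_divided_difference (\<beta> # \<beta>s) (left_quotient \<alpha> ((char_mult \<alpha> ^^ Suc (length \<beta>s)) g))"
      by (simp add: left_divided_difference_def)
    also have "\<dots> = left_divided_difference (\<beta> # \<beta>s)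
        ((char_mult \<beta> ^^ length \<beta>s) (linear_mult (quat_cnj \<alpha>) g))"
      by (simp only: left_quotient_char_mult flip: char_mult_cong[OF eq])
    also have "\<dots> = c * (\<beta> - quat_cnj \<alpha>) * left_eval g \<alpha>"
      by (simp add: c(2) left_eval_linear_mult_cnj[OF eq] mult.assoc)
    finally show ?thesis .
  qed
  with c(1) ne show ?case
    by (intro exI[of _ "c * (\<beta> - quat_cnj \<alpha>)"]) simp
qed

lemma left_divided_difference_take_char_mult:
  assumes "spherical_chain \<alpha>s" "i < length \<alpha>s" "\<alpha>s ! 0 \<sim>\<^sub>q \<alpha>"
  obtains c where "c \<noteq> 0" and "\<And>g. left_divided_difference (take (Suc i) \<alpha>s)
    ((char_mult \<alpha> ^^ i) g) = c * left_eval g (\<alpha>s ! 0)"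
proof -
  obtain \<beta> \<beta>s where eq: "\<alpha>s = \<beta> # \<beta>s"
    using assms(2) by (cases \<alpha>s) auto
  have "spherical_chain (\<beta> # take i \<beta>s)" "length (take i \<beta>s) = i" "char_mult \<beta> = char_mult \<alpha>"
    using spherical_chain_take[OF assms(1), of i] assms(2,3) char_mult_cong eq by auto
  with left_divided_difference_char_mult[of \<beta> "take i \<beta>s"] show ?thesis
    using that eq by auto
qed

lemma left_divided_difference_take_annihilates:
  assumes "spherical_chain \<alpha>s" "i < m" "i < length \<alpha>s" "\<alpha>s ! 0 \<sim>\<^sub>q \<alpha>"
  shows "left_divided_difference (take (Suc i) \<alpha>s) ((char_mult \<alpha> ^^ m) g) = 0"
proof -
  obtain c where c: "\<And>g. left_divided_difference (take (Suc i) \<alpha>s) ((char_mult \<alpha> ^^ i) g)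
      = c * left_eval g (\<alpha>s ! 0)"
    using left_divided_difference_take_char_mult[OF assms(1,3,4)] by metis
  \<comment> \<open>Writing m - i as a successor exposes one spare factor \<chi>, which vanishes at
    the first node.\<close>
  have "(char_mult \<alpha> ^^ m) g = (char_mult \<alpha> ^^ i) ((char_mult \<alpha> ^^ Suc (m - Suc i)) g)"
    using assms(2) by (metis Suc_diff_Suc comp_apply funpow_add le_add_diff_inverse less_imp_le)
  then have "left_divided_difference (take (Suc i) \<alpha>s) ((char_mult \<alpha> ^^ m) g)
      = c * left_eval (char_mult \<alpha> ((char_mult \<alpha> ^^ (m - Suc i)) g)) (\<alpha>s ! 0)"
    by (simp add: c)
  also have "\<dots> = 0"
    by (simp flip: char_mult_cong[OF assms(4)])
  finally show ?thesis .
qed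

section \<open>Functionals vanishing on multiples of powers of \<chi>\<close>

lemma right_linear_annihilator_char_mult:
  assumes lin: "right_linear \<phi>" and ann: "\<And>g. \<phi> (char_mult \<alpha> g) = 0"
    and eqv: "\<beta> \<sim>\<^sub>q \<alpha>" "\<gamma> \<sim>\<^sub>q \<alpha>" and "\<beta> \<noteq> \<gamma>"
  obtains a b where "\<And>f. \<phi> f = a * left_eval f \<beta> + b * left_eval f \<gamma>"
proof -
  \<comment> \<open>With a = \<phi>(1) + w and b = -w, this w solves a + b = \<phi>(1) and a \<beta>
    + b \<gamma> = \<phi>(z).\<close>
  define w where "w = (\<phi> [:0, 1:] - \<phi> [:1:] * \<beta>) * inverse (\<beta> - \<gamma>)"
  have "\<phi> f = (\<phi> [:1:] + w) * left_eval f \<beta> + (- w) * left_eval f \<gamma>" for f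
  proof -
    \<comment> \<open>Dividing by z - \<alpha> and then by its conjugate factor divides f by \<chi>,
      with remainder u + z v.\<close>
    define q where "q = left_quotient (quat_cnj \<alpha>) (left_quotient \<alpha> f)"
    define v where "v = left_eval (left_quotient \<alpha> f) (quat_cnj \<alpha>)"
    define u where "u = left_eval f \<alpha> - \<alpha> * v"
    have "f = [:left_eval f \<alpha>:] + linear_mult \<alpha> ([:v:] + linear_mult (quat_cnj \<alpha>) q)"
      unfolding v_def q_def by (metis left_division_poly)
    then have f: "f = [:u, v:] + char_mult \<alpha> q"
      by (simp add: linear_mult_add linear_mult_const char_mult_def u_def flip: add.assoc)
    have ev: "left_eval f \<delta> = u + \<delta> * v" if "\<delta> \<sim>\<^sub>q \<alpha>" for \<delta>
    proof -
      \<comment> \<open>Since \<delta> is conjugate to \<alpha>, \<chi> can be factored through z -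
        \<delta> instead.\<close>
      have "f = [:u + \<delta> * v:] + linear_mult \<delta> ([:v:] + linear_mult (quat_cnj \<delta>) q)"
        unfolding f char_mult_cong[OF that, symmetric]
        by (simp add: linear_mult_add linear_mult_const char_mult_def flip: add.assoc)
      then show ?thesis
        by (rule left_division_unique)
    qed
    have "[:u, v:] = right_scale [:1:] u + right_scale [:0, 1:] v"
      by (simp add: right_scale_pCons)
    then have "\<phi> f = \<phi> [:1:] * u + \<phi> [:0, 1:] * v"
      using lin ann by (simp add: f right_linear_def)
    moreover have "w * left_eval f \<beta> - w * left_eval f \<gamma> = (\<phi> [:0, 1:] - \<phi> [:1:] * \<beta>) * v"
    proof -
      have "left_eval f \<beta> - left_eval f \<gamma> = (\<beta> - \<gamma>) * v"
        by (simp add: ev eqv left_diff_distrib)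
      then have "w * left_eval f \<beta> - w * left_eval f \<gamma> = w * (\<beta> - \<gamma>) * v"
        by (simp add: mult.assoc flip: right_diff_distrib)
      also have "w * (\<beta> - \<gamma>) = \<phi> [:0, 1:] - \<phi> [:1:] * \<beta>"
        using \<open>\<beta> \<noteq> \<gamma>\<close> by (simp add: w_def mult.assoc)
      finally show ?thesis .
    qed
    ultimately show ?thesis
      by (simp add: ev[OF eqv(1)] algebra_simps)
  qed
  then show ?thesis
    by (rule that)
qed

lemma right_linear_annihilator_funpow_char_mult:
  assumes chains: "spherical_chain \<beta>s" "spherical_chain \<gamma>s"
    and len: "m \<le> length \<beta>s" "m \<le> length \<gamma>s"
    and eqv: "\<beta>s ! 0 \<sim>\<^sub>q \<alpha>" "\<gamma>s ! 0 \<sim>\<^sub>q \<alpha>" and ne: "\<beta>s ! 0 \<noteq> \<gamma>s ! 0"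
    and lin: "right_linear \<phi>" and ann: "\<And>g. \<phi> ((char_mult \<alpha> ^^ m) g) = 0"
  shows "\<exists>A B. \<forall>f. \<phi> f =
    (\<Sum>i<m. A i * left_divided_difference (take (Suc i) \<beta>s) f) +
    (\<Sum>i<m. B i * left_divided_difference (take (Suc i) \<gamma>s) f)"
  using len lin ann
proof (induction m arbitrary: \<phi>)
  case 0
  then show ?case by simp
next
  case (Suc m)
  let ?D = "\<lambda>\<delta>s. left_divided_difference (take (Suc m) \<delta>s)"
  from Suc.prems have m: "m < length \<beta>s" "m < length \<gamma>s"
    by simp_all
  obtain c where c: "c \<noteq> 0" "\<And>g. ?D \<beta>s ((char_mult \<alpha> ^^ m) g) = c * left_eval g (\<beta>s ! 0)"
    using left_divided_difference_take_char_mult[OF chains(1) m(1) eqv(1)] by blast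
  obtain d where d: "d \<noteq> 0" "\<And>g. ?D \<gamma>s ((char_mult \<alpha> ^^ m) g) = d * left_eval g (\<gamma>s ! 0)"
    using left_divided_difference_take_char_mult[OF chains(2) m(2) eqv(2)] by blast
  \<comment> \<open>The functional sending g to \<phi>(\<chi>^m g) kills multiples of \<chi>, so the
    case of a single factor applies to it.\<close>
  have "\<phi> ((char_mult \<alpha> ^^ m) (char_mult \<alpha> g)) = 0" for g
    using Suc.prems(4)[of g] by (simp add: funpow_swap1)
  then obtain a b where ab:
    "\<And>g. \<phi> ((char_mult \<alpha> ^^ m) g) = a * left_eval g (\<beta>s ! 0) + b * left_eval g (\<gamma>s ! 0)"
    using right_linear_annihilator_char_mult[OF
        right_linear_funpow_char_mult[OF Suc.prems(3)] _ eqv ne] by blast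
  \<comment> \<open>On \<chi>^m g the two corrections equal the two terms of \<open>ab\<close>,
    because the inverses cancel the factors c and d.\<close>
  define \<psi> where "\<psi> f = \<phi> f - a * inverse c * ?D \<beta>s f - b * inverse d * ?D \<gamma>s f" for f
  have "right_linear \<psi>"
    unfolding \<psi>_def
    by (intro right_linear_diff_mult Suc.prems(3) right_linear_left_divided_difference)
  moreover have "\<psi> ((char_mult \<alpha> ^^ m) g) = 0" for g
  proof -
    have "x * inverse y * (y * e) = x * e" if "y \<noteq> 0" for x y e :: quat
      by (metis that left_inverse mult.assoc mult_1_right)
    with c(1) d(1) show ?thesis
      by (simp add: \<psi>_def c(2) d(2) ab)
  qed
  ultimately obtain A B where AB: "\<And>f. \<psi> f =
      (\<Sum>i<m. A i * left_divided_difference (take (Suc i) \<beta>s) f) +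
      (\<Sum>i<m. B i * left_divided_difference (take (Suc i) \<gamma>s) f)"
    using Suc.IH[of \<psi>] m by (meson less_imp_le)
  have "\<phi> f = \<psi> f + a * inverse c * ?D \<beta>s f + b * inverse d * ?D \<gamma>s f" for f
    by (simp add: \<psi>_def)
  then show ?case
    \<comment> \<open>The sums for \<psi> stop below m, so the entries at m are free to take the
      correction coefficients.\<close>
    by (intro exI[of _ "A(m := a * inverse c)"] exI[of _ "B(m := b * inverse d)"])
      (simp add: AB algebra_simps)
qed

theorem theorem1p4:
  fixes S :: "quat set" and k :: nat and \<alpha>\<^sub>1 \<alpha>\<^sub>2 \<alpha>\<^sub>3 :: "quat list"
  assumes "S \<in> conjugacy_classes"
    and "spherical_chain \<alpha>\<^sub>1" "length \<alpha>\<^sub>1 = k" "set \<alpha>\<^sub>1 \<subseteq> S"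
    and "spherical_chain \<alpha>\<^sub>2" "length \<alpha>\<^sub>2 = k" "set \<alpha>\<^sub>2 \<subseteq> S"
    and "spherical_chain \<alpha>\<^sub>3" "length \<alpha>\<^sub>3 = k" "set \<alpha>\<^sub>3 \<subseteq> S"
    and "\<alpha>\<^sub>1 ! 0 \<noteq> \<alpha>\<^sub>2 ! 0"
  shows "\<exists>A \<in> carrier_mat k k. \<exists>B \<in> carrier_mat k k. \<forall>f :: quat poly.
    left_divided_differences \<alpha>\<^sub>3 f =
      A *\<^sub>v left_divided_differences \<alpha>\<^sub>1 f + B *\<^sub>v left_divided_differences \<alpha>\<^sub>2 f"
proof -
  have k: "0 < k"
    using assms(2,3) by (auto simp: spherical_chain_def)
  \<comment> \<open>A representative of S, used to fix \<chi>.\<close>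
  define \<sigma> where "\<sigma> = \<alpha>\<^sub>1 ! 0"
  have eqv: "\<alpha>s ! 0 \<sim>\<^sub>q \<sigma>" if "set \<alpha>s \<subseteq> S" "length \<alpha>s = k" for \<alpha>s
    unfolding \<sigma>_def using that assms(3,4) k
    by (intro conjugacy_class_equiv[OF assms(1)]) (auto intro: nth_mem)
  define P where "P i A B \<longleftrightarrow> (\<forall>f. left_divided_difference (take (Suc i) \<alpha>\<^sub>3) f =
      (\<Sum>j<k. A j * left_divided_difference (take (Suc j) \<alpha>\<^sub>1) f) +
      (\<Sum>j<k. B j * left_divided_difference (take (Suc j) \<alpha>\<^sub>2) f))" for i A B
  \<comment> \<open>Each entry for the third chain is a functional killing multiples of \<chi>^k, as
    i < k; its coefficients form row i of the two matrices.\<close>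
  have "\<exists>A B. P i A B" if "i < k" for i
    unfolding P_def using assms that
    by (intro right_linear_annihilator_funpow_char_mult[where \<alpha> = \<sigma>]
        right_linear_left_divided_difference left_divided_difference_take_annihilates eqv) simp_all
  then obtain A B where "\<And>i. i < k \<Longrightarrow> P i (A i) (B i)"
    by metis
  then have AB: "left_divided_difference (take (Suc i) \<alpha>\<^sub>3) f =
      (\<Sum>j<k. A i j * left_divided_difference (take (Suc j) \<alpha>\<^sub>1) f) +
      (\<Sum>j<k. B i j * left_divided_difference (take (Suc j) \<alpha>\<^sub>2) f)" if "i < k" for i f
    using that by (simp add: P_def)
  show ?thesis
  proof (intro bexI allI)
    fix f
    show "left_divided_differences \<alpha>\<^sub>3 f =
        mat k k (\<lambda>(i, j). A i j) *\<^sub>v left_divided_differences \<alpha>\<^sub>1 f +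
        mat k k (\<lambda>(i, j). B i j) *\<^sub>v left_divided_differences \<alpha>\<^sub>2 f"
      using assms(3,6,9)
      by (intro eq_vecI)
        (simp_all add: left_divided_differences_def AB scalar_prod_def atLeast0LessThan)
  qed simp_all
qed

end
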